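(* Let $H=(\sigma,\alpha)$ be a connected orientable hypermap and let $E'\subseteq E(H)$. The partial dual $H^{E'}$ is Eulerian if and only if every state circle of the state $S_{E'}$ of the medial map $M(H)$ has even length.
   Context: Permutations are composed from right to left. A connected orientable hypermap is a pair $H=(\sigma,\alpha)$ of permutations of a finite set $D=\{1,\dots,n\}$ of darts such that the group generated by $\sigma,\alpha$ acts transitively on $D$. Vertices are the cycles of $\sigma$ and hyperedges are the cycles of $\alpha$ (fixed points count as cycles of length 1); $E(H)$ is the set of hyperedges. A hypermap is Eulerian if every cycle of its vertex permutation has even length. Partial dual. For $E'\subseteq E(H)$, let $\alpha_{E'}$ be the product of the $\alpha$-cycles in $E'$ and $\alpha_{\overline{E'}}$ the product of the remaining $\alpha$-cycles. The partial dual is the hypermap $H^{E'}=(\sigma^{E'},\alpha^{E'})$ with vertex permutation $\sigma^{E'}=\alpha_{E'}^{-1}\sigma$ and hyperedge permutation $\alpha^{E'}=\alpha_{E'}^{-1}\alpha_{\overline{E'}}$. Medial map. Let $D^{\pm}=\{i^-,i^+: i\in D\}$ (the half-edges of $M(H)$). The medial map $M(H)$ has one vertex $v_e$ for each hyperedge $e=(i_1\,i_2\cdots i_k)$, with cyclic order of half-edges $(i_1^-\,i_1^+\,i_2^-\,i_2^+\cdots i_k^-\,i_k^+)$, and one edge $m_i=(i^+,\sigma(i)^-)$ for each dart $i\in D$, with ends $i^+$ and $\sigma(i)^-$. At $v_e$ the black corners are the pairs $(i_j^-,i_j^+)$ and the white corners are the pairs $(i_j^+,i_{j+1}^-)$,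 $1\le j\le k$, $i_{k+1}:=i_1$. States. The black smoothing at $v_e$ removes $v_e$ and connects, for every $j$, the two half-edges $i_j^-,i_j^+$ of each black corner; the white smoothing at $v_e$ removes $v_e$ and connects, for every $j$, the two half-edges $i_j^+,i_{j+1}^-$ of each white corner (each such connection is a degree-2 vertex). The state $S_{E'}$ is the 2-regular graph obtained from $M(H)$ by applying the white smoothing at $v_e$ for every $e\in E'$ and the black smoothing at $v_e$ for every $e\notin E'$. Its connected components are the state circles; the length of a state circle is the number of medial edges $m_i$ it contains. *)

theory Defs
  imports "HOL-Combinatorics.Orbits" "HOL-Algebra.Sym_Groups"
begin

record hypermap =
  num_darts :: nat
  vertex_perm :: "nat \<Rightarrow> nat"
  hyperedge_perm :: "nat \<Rightarrow> nat"

definition darts :: "hypermap \<Rightarrow> nat set" where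
  "darts H = {1..num_darts H}"

definition connected_hypermap :: "hypermap \<Rightarrow> bool" where
  "connected_hypermap H \<longleftrightarrow>
     vertex_perm H permutes darts H \<and>
     hyperedge_perm H permutes darts H \<and>
     (\<forall>x\<in>darts H. \<forall>y\<in>darts H.
        \<exists>g\<in>generate (sym_group (num_darts H)) {vertex_perm H, hyperedge_perm H}. g x = y)"

text \<open>A cycle of a permutation is represented by its set of elements, which determines it as a
  cyclic permutation; fixed points give singletons.\<close>

definition vertices :: "hypermap \<Rightarrow> nat set set" where
  "vertices H = orbit (vertex_perm H) ` darts H"

definition hyperedges :: "hypermap \<Rightarrow> nat set set" where
  "hyperedges H = orbit (hyperedge_perm H) ` darts H"

definition eulerian :: "hypermap \<Rightarrow> bool" where
  "eulerian H \<longleftrightarrow> (\<forall>c\<in>vertices H. even (card c))"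

text \<open>The product of a set of (pairwise disjoint, hence commuting) cycles of \<open>p\<close>: it acts as \<open>p\<close> on
  the union of these cycles and fixes all other points.\<close>

definition cycle_product :: "('a \<Rightarrow> 'a) \<Rightarrow> 'a set set \<Rightarrow> 'a \<Rightarrow> 'a" where
  "cycle_product p C = perm_restrict p (\<Union>C)"

lemma cycle_product_eq_foldr:
  assumes "\<And>c. c \<in> set cs \<Longrightarrow> cyclic_on p c"
    and "\<And>c d. c \<in> set cs \<Longrightarrow> d \<in> set cs \<Longrightarrow> c \<noteq> d \<Longrightarrow> c \<inter> d = {}"
    and "distinct cs"
  shows "cycle_product p (set cs) = foldr (\<circ>) (map (perm_restrict p) cs) id"
  using assms
proof (induction cs)
  case Nil
  show ?case by (auto simp: cycle_product_def perm_restrict_def fun_eq_iff)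
next
  case (Cons c cs)
  have disj: "c \<inter> \<Union>(set cs) = {}"
    using Cons.prems(2,3) by fastforce
  have closed: "p x \<in> \<Union>(set cs)" if "x \<in> \<Union>(set cs)" for x
    using that Cons.prems(1) cyclic_on_inI by (metis UnionE UnionI list.set_intros(2))
  have IH: "cycle_product p (set cs) = foldr (\<circ>) (map (perm_restrict p) cs) id"
    by (rule Cons.IH) (use Cons.prems in auto)
  have "cycle_product p (set (c # cs)) = perm_restrict p c \<circ> cycle_product p (set cs)"
    using disj closed by (auto simp: cycle_product_def perm_restrict_def fun_eq_iff)
  moreover have "foldr f (x # xs) z = f x (foldr f xs z)"
    for f :: "('a \<Rightarrow> 'a) \<Rightarrow> ('a \<Rightarrow> 'a) \<Rightarrow> 'a \<Rightarrow> 'a" and x xs z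
    by simp
  ultimately show ?case by (simp only: IH list.map)
qed

definition partial_dual :: "hypermap \<Rightarrow> nat set set \<Rightarrow> hypermap" where
  "partial_dual H E' =
     (let a = cycle_product (hyperedge_perm H) E';
          b = cycle_product (hyperedge_perm H) (hyperedges H - E')
      in \<lparr> num_darts = num_darts H,
           vertex_perm = inv_into UNIV a \<circ> vertex_perm H,
           hyperedge_perm = inv_into UNIV a \<circ> b \<rparr>)"

text \<open>\<open>Minus i\<close> and \<open>Plus i\<close> are the half-edges usually written as \<open>i\<close> with superscript minus or plus.\<close>

datatype half_edge = Minus nat | Plus nat

text \<open>A map is given by its half-edges, the permutation sending each half-edge to the next one in
  the cyclic order at its vertex (so vertices are the cycles of this permutation; its values outside the half-edges are
  irrelevant), and its edges, each being the set of its two half-edges.\<close>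

record half_edge_map =
  half_edges :: "half_edge set"
  next_at_vertex :: "half_edge \<Rightarrow> half_edge"
  edges :: "half_edge set set"

definition medial_edge :: "hypermap \<Rightarrow> nat \<Rightarrow> half_edge set" where
  "medial_edge H i = {Plus i, Minus (vertex_perm H i)}"

text \<open>For a hyperedge \<open>(i\<^sub>1 \<dots> i\<^sub>k)\<close> the function \<open>next_at_vertex\<close> below has the cycle
  \<open>(Minus i\<^sub>1, Plus i\<^sub>1, Minus i\<^sub>2, \<dots>, Plus i\<^sub>k)\<close>, because the hyperedge permutation sends
  each \<open>i\<^sub>j\<close> to its successor.\<close>

definition medial_map :: "hypermap \<Rightarrow> half_edge_map" where
  "medial_map H =
     \<lparr> half_edges = Minus ` darts H \<union> Plus ` darts H,
       next_at_vertex = (\<lambda>h. case h of Minus i \<Rightarrow> Plus i | Plus i \<Rightarrow> Minus (hyperedge_perm H i)),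
       edges = medial_edge H ` darts H \<rparr>"

definition black_corners :: "hypermap \<Rightarrow> nat set \<Rightarrow> half_edge set set" where
  "black_corners H e = {{h, next_at_vertex (medial_map H) h} | h. h \<in> Minus ` e}"

definition white_corners :: "hypermap \<Rightarrow> nat set \<Rightarrow> half_edge set set" where
  "white_corners H e = {{h, next_at_vertex (medial_map H) h} | h. h \<in> Plus ` e}"

text \<open>A multigraph, possibly with loops, in half-edge form: nodes and links are both sets of
  half-edges, and a link is incident to the nodes containing one of its half-edges.\<close>

record half_edge_graph =
  nodes :: "half_edge set set"
  links :: "half_edge set set"

definition state :: "hypermap \<Rightarrow> nat set set \<Rightarrow> half_edge_graph" where
  "state H E' =
     \<lparr> nodes = (\<Union>e\<in>hyperedges H. if e \<in> E' then white_corners H e else black_corners H e),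
       links = edges (medial_map H) \<rparr>"

definition adjacency :: "half_edge_graph \<Rightarrow> (half_edge set \<times> half_edge set) set" where
  "adjacency S = {(u, v). u \<in> nodes S \<and> v \<in> nodes S \<and>
     (\<exists>m\<in>links S. m \<inter> u \<noteq> {} \<and> m \<inter> v \<noteq> {})}"

text \<open>Connected components, represented by their node sets.\<close>

definition state_circles :: "half_edge_graph \<Rightarrow> half_edge set set set" where
  "state_circles S = nodes S // {(u, v). u \<in> nodes S \<and> (u, v) \<in> (adjacency S)\<^sup>*}"

definition circle_length :: "half_edge_graph \<Rightarrow> half_edge set set \<Rightarrow> nat" where
  "circle_length S C = card {m \<in> links S. \<exists>u\<in>C. m \<inter> u \<noteq> {}}"

end

theory Submission
  imports Defs
begin

text \<open>
  Write \<open>\<sigma>\<close> and \<open>\<alpha>\<close> for the vertex and hyperedge permutations, \<open>a\<close> for the product of the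
  \<open>\<alpha>\<close>-cycles in \<open>E'\<close>, and \<open>\<tau> = a\<^sup>-\<^sup>1 \<circ> \<sigma>\<close> for the vertex permutation of the partial dual.
  The state circles are the cycles of \<open>\<tau>\<close>, with lengths preserved.

  The reason is that one formula describes both smoothings. A black corner is
  \<open>{Plus k, Minus k}\<close> and a white corner is \<open>{Plus k, Minus (\<alpha> k)}\<close>; as \<open>a\<close> is \<open>\<alpha>\<close> on the
  hyperedges in \<open>E'\<close> and the identity on the others, the nodes of the state are exactly the pairs
  \<open>{Plus k, Minus (a k)}\<close>, one for each dart \<open>k\<close> (lemma \<open>nodes_state\<close>). The medial edge
  \<open>{Plus i, Minus (\<sigma> i)}\<close> leaves the node of \<open>i\<close> through \<open>Plus i\<close> and enters the node of the dart \<open>k\<close>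
  with \<open>a k = \<sigma> i\<close>, which is \<open>k = \<tau> i\<close> (lemma \<open>medial_edge_meets_iff\<close>). So, walking along a state circle,
  one alternately meets the nodes and the medial edges of \<open>i, \<tau> i, \<tau> (\<tau> i), \<dots>\<close>: the circles are
  the \<open>\<tau>\<close>-orbits (lemma \<open>state_circles_eq\<close>), and a circle contains one medial edge for each element of its
  orbit (lemma \<open>circle_length_eq\<close>). Parity then transfers circle by circle.
\<close>

lemma cycle_product_permutes:
  assumes "p permutes S" and "\<And>c. c \<in> C \<Longrightarrow> cyclic_on p c"
  shows "cycle_product p C permutes \<Union>C"
proof (rule bij_imp_permutes)
  have "p ` \<Union>C = \<Union>C"
  proof
    show "p ` \<Union>C \<subseteq> \<Union>C"
      using assms(2) cyclic_on_inI by fast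
    show "\<Union>C \<subseteq> p ` \<Union>C"
    proof
      fix x assume "x \<in> \<Union>C"
      then obtain c where c: "c \<in> C" "x \<in> c" by blast
      have x: "p (inv_into UNIV p x) = x"
        using assms(1) by (simp add: permutes_inverses)
      then have "inv_into UNIV p x \<in> c"
        using cyclic_on_f_in[OF assms(1) assms(2)[OF c(1)]] c(2) by simp
      with x c(1) show "x \<in> p ` \<Union>C" by (metis UnionI imageI)
    qed
  qed
  then have "bij_betw p (\<Union>C) (\<Union>C)"
    using permutes_inj_on[OF assms(1)] by (simp add: bij_betw_def)
  then show "bij_betw (cycle_product p C) (\<Union>C) (\<Union>C)"
    unfolding cycle_product_def by (subst bij_betw_cong[where g = p]) (auto simp: perm_restrict_simps)
qed (simp add: cycle_product_def perm_restrict_simps)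

text \<open>Indexing the corners by their \<open>Plus\<close> half-edge is what makes the walk along a circle advance by
  \<open>a\<^sup>-\<^sup>1 \<circ> \<sigma>\<close> itself; indexing by the \<open>Minus\<close> half-edge would give the conjugate \<open>\<sigma> \<circ> a\<^sup>-\<^sup>1\<close>.\<close>

definition state_node :: "hypermap \<Rightarrow> nat set set \<Rightarrow> nat \<Rightarrow> half_edge set" where
  "state_node H E' k = {Plus k, Minus (cycle_product (hyperedge_perm H) E' k)}"

lemma inj_state_node: "inj (state_node H E')"
  by (auto simp: inj_def state_node_def doubleton_eq_iff)

lemma inj_medial_edge: "inj (medial_edge H)"
  by (auto simp: inj_def medial_edge_def doubleton_eq_iff)

context
  fixes H :: hypermap and E' :: "nat set set"
  assumes conn: "connected_hypermap H" and sub: "E' \<subseteq> hyperedges H"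
begin

private abbreviation "D \<equiv> darts H"
private abbreviation "\<sigma> \<equiv> vertex_perm H"
private abbreviation "\<alpha> \<equiv> hyperedge_perm H"
private abbreviation "a \<equiv> cycle_product \<alpha> E'"
private abbreviation "\<tau> \<equiv> vertex_perm (partial_dual H E')"

lemma finite_darts: "finite D"
  by (simp add: darts_def)

lemma cyclic_on_hyperedge: "e \<in> hyperedges H \<Longrightarrow> cyclic_on \<alpha> e"
  using conn finite_darts by (auto simp: connected_hypermap_def hyperedges_def intro: cyclic_on_orbit)

lemma Union_hyperedges: "\<Union>(hyperedges H) = D"
proof
  have \<alpha>: "\<alpha> permutes D" using conn by (simp add: connected_hypermap_def)
  then show "\<Union>(hyperedges H) \<subseteq> D"
    using permutes_orbit_subset by (fastforce simp: hyperedges_def)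
  have "k \<in> orbit \<alpha> k" for k
    by (rule permutation_self_in_orbit)
      (use \<alpha> finite_darts permutation_permutes in blast)
  then show "D \<subseteq> \<Union>(hyperedges H)" by (auto simp: hyperedges_def)
qed

lemma hyperedges_disjoint:
  "e \<in> hyperedges H \<Longrightarrow> f \<in> hyperedges H \<Longrightarrow> k \<in> e \<Longrightarrow> k \<in> f \<Longrightarrow> e = f"
  using cyclic_on_hyperedge orbit_cyclic_eq3 by metis

lemma dual_factor_permutes: "a permutes D"
proof (rule permutes_subset)
  show "a permutes \<Union>E'"
    using conn sub cyclic_on_hyperedge
    by (intro cycle_product_permutes[of _ D]) (auto simp: connected_hypermap_def)
  show "\<Union>E' \<subseteq> D" using sub Union_hyperedges by blast
qed

lemma dual_vertex_perm: "\<tau> = inv_into UNIV a \<circ> \<sigma>"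
  by (simp add: partial_dual_def Let_def)

lemma dual_vertex_perm_permutes: "\<tau> permutes D"
  unfolding dual_vertex_perm using conn dual_factor_permutes
  by (intro permutes_compose permutes_inv) (simp_all add: connected_hypermap_def)

lemma dual_factor_eq_iff: "a k = \<sigma> i \<longleftrightarrow> k = \<tau> i"
  using permutes_inv_eq[OF dual_factor_permutes] by (metis comp_apply dual_vertex_perm)

text \<open>Both smoothings at once: a corner at a hyperedge \<open>e\<close> joins \<open>Plus k\<close> to the \<open>Minus\<close> half-edge
  of \<open>\<alpha> k\<close> or of \<open>k\<close> according to whether \<open>e\<close> is in \<open>E'\<close>, that is, to \<open>Minus (a k)\<close>.\<close>

lemma nodes_state: "nodes (state H E') = state_node H E' ` D"
proof -
  have corners: "(if e \<in> E' then white_corners H e else black_corners H e) = state_node H E' ` e"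
    if e: "e \<in> hyperedges H" for e
  proof (cases "e \<in> E'")
    case True
    then have "a k = \<alpha> k" if "k \<in> e" for k
      using that by (auto simp: cycle_product_def perm_restrict_def)
    with True show ?thesis
      by (simp add: white_corners_def medial_map_def state_node_def Setcompr_eq_image
          image_image insert_commute cong: image_cong_simp)
  next
    case False
    then have "k \<notin> \<Union>E'" if "k \<in> e" for k
      using that e sub hyperedges_disjoint by blast
    then have "a k = k" if "k \<in> e" for k
      using that by (simp add: cycle_product_def perm_restrict_def)
    with False show ?thesis
      by (simp add: black_corners_def medial_map_def state_node_def Setcompr_eq_image
          image_image insert_commute cong: image_cong_simp)
  qed
  have "nodes (state H E') = (\<Union>e\<in>hyperedges H. state_node H E' ` e)"
    by (simp add: state_def corners)
  also have "\<dots> = state_node H E' ` D"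
    unfolding Union_hyperedges[symmetric] by blast
  finally show ?thesis .
qed

lemma links_state: "links (state H E') = medial_edge H ` D"
  by (simp add: state_def medial_map_def)

lemma medial_edge_meets_iff:
  "medial_edge H i \<inter> state_node H E' k \<noteq> {} \<longleftrightarrow> k = i \<or> k = \<tau> i"
  using dual_factor_eq_iff[of k i] by (auto simp: medial_edge_def state_node_def)

lemma adjacency_state:
  "(state_node H E' i, state_node H E' j) \<in> adjacency (state H E') \<longleftrightarrow>
     i \<in> D \<and> j \<in> D \<and> (\<exists>l\<in>D. (i = l \<or> i = \<tau> l) \<and> (j = l \<or> j = \<tau> l))"
  by (simp add: adjacency_def nodes_state links_state medial_edge_meets_iff
      inj_image_mem_iff[OF inj_state_node])

lemma self_in_dual_orbit: "k \<in> orbit \<tau> k"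
  by (rule permutation_self_in_orbit)
    (use dual_vertex_perm_permutes finite_darts permutation_permutes in blast)

lemma dual_orbit_step: "\<tau> i \<in> orbit \<tau> k \<longleftrightarrow> i \<in> orbit \<tau> k"
  using cyclic_on_f_in[OF dual_vertex_perm_permutes cyclic_on_orbit] dual_vertex_perm_permutes
    finite_darts orbit.step by metis

text \<open>No step leaves the orbit, because an edge only joins nodes \<open>l\<close> and \<open>\<tau> l\<close>. Conversely the edge of \<open>l\<close>
  makes the step from \<open>l\<close> to \<open>\<tau> l\<close>, and such forward steps exhaust the orbit.\<close>

lemma reachable_state_node:
  assumes "k \<in> D"
  shows "(state_node H E' k, v) \<in> (adjacency (state H E'))\<^sup>* \<longleftrightarrow> v \<in> state_node H E' ` orbit \<tau> k"
proof
  assume "(state_node H E' k, v) \<in> (adjacency (state H E'))\<^sup>*"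
  then show "v \<in> state_node H E' ` orbit \<tau> k"
  proof induction
    case base
    show ?case using self_in_dual_orbit by blast
  next
    case (step u v)
    then obtain i where i: "i \<in> orbit \<tau> k" "u = state_node H E' i" by blast
    have "v \<in> nodes (state H E')"
      using step.hyps(2) by (simp add: adjacency_def)
    then obtain j where j: "v = state_node H E' j"
      unfolding nodes_state by blast
    have "j \<in> orbit \<tau> k"
      using step.hyps(2) i(1) unfolding i(2) j adjacency_state by (metis dual_orbit_step)
    then show ?case unfolding j by (rule imageI)
  qed
next
  have edge: "(state_node H E' i, state_node H E' (\<tau> i)) \<in> adjacency (state H E')"
    if "i \<in> D" for i
    using that dual_vertex_perm_permutes by (auto simp: adjacency_state permutes_in_image)
  have "(state_node H E' k, state_node H E' j) \<in> (adjacency (state H E'))\<^sup>*"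
    if "j \<in> orbit \<tau> k" for j
    using that
  proof induction
    case base
    show ?case using edge[OF assms] by blast
  next
    case (step j)
    moreover have "j \<in> D"
      using step.hyps permutes_orbit_subset[OF dual_vertex_perm_permutes assms] by blast
    ultimately show ?case using edge by (meson rtrancl.rtrancl_into_rtrancl)
  qed
  then show "(state_node H E' k, v) \<in> (adjacency (state H E'))\<^sup>*"
    if "v \<in> state_node H E' ` orbit \<tau> k"
    using that by blast
qed

lemma state_circles_eq:
  "state_circles (state H E') = (\<lambda>c. state_node H E' ` c) ` vertices (partial_dual H E')"
proof -
  have "{(u, v). u \<in> nodes (state H E') \<and> (u, v) \<in> (adjacency (state H E'))\<^sup>*} `` {state_node H E' k}
      = state_node H E' ` orbit \<tau> k" if "k \<in> D" for k
    using that by (auto simp: nodes_state reachable_state_node)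
  moreover have "darts (partial_dual H E') = D"
    by (simp add: darts_def partial_dual_def Let_def)
  ultimately show ?thesis
    unfolding state_circles_def quotient_def vertices_def by (auto simp: nodes_state)
qed

text \<open>The edge of \<open>i\<close> touches the nodes of \<open>i\<close> and \<open>\<tau> i\<close>, and an orbit contains both of these darts or
  neither. So the edges of a circle are indexed by the same orbit as its nodes, and distinct darts
  give distinct edges since each edge has only one \<open>Plus\<close> end.\<close>

lemma circle_length_eq:
  assumes "c \<in> vertices (partial_dual H E')"
  shows "circle_length (state H E') (state_node H E' ` c) = card c"
proof -
  obtain k where k: "k \<in> D" "c = orbit \<tau> k"
    using assms by (auto simp: vertices_def darts_def partial_dual_def Let_def)
  have "c \<subseteq> D"
    using k permutes_orbit_subset[OF dual_vertex_perm_permutes] by blast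
  have "{m \<in> links (state H E'). \<exists>u\<in>state_node H E' ` c. m \<inter> u \<noteq> {}} = medial_edge H ` c"
  proof -
    have "(\<exists>u\<in>state_node H E' ` c. medial_edge H i \<inter> u \<noteq> {}) \<longleftrightarrow> i \<in> c" for i
      by (simp add: medial_edge_meets_iff k(2)) (metis dual_orbit_step)
    then show ?thesis
      using \<open>c \<subseteq> D\<close> unfolding links_state by blast
  qed
  then show ?thesis
    unfolding circle_length_def
    by (simp add: card_image inj_on_subset[OF inj_medial_edge])
qed

end

theorem corollary4p3:
  fixes H :: hypermap and E' :: "nat set set"
  assumes "connected_hypermap H"
    and "E' \<subseteq> hyperedges H"
  shows "eulerian (partial_dual H E') \<longleftrightarrow>
    (\<forall>C\<in>state_circles (state H E'). even (circle_length (state H E') C))"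
  by (simp add: eulerian_def state_circles_eq[OF assms] circle_length_eq[OF assms])

end
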